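(* Let $T\ge1$ and $0<\epsilon\le1$. Let $\Lambda:[0,\infty)\to[0,\infty)$ be one of $\Lambda(t)=e^{-\lambda t}$, $\Lambda(t)=1$, $\Lambda(t)=e^{\lambda t}$, with fixed $\lambda>0$ in the exponential cases, let $C_{\rm step}>0$ with $C_{\rm step}=O(1)$, and set, correspondingly, $$M=\begin{cases}\left\lceil\max\left\{1,\,T,\,\lambda T,\,\dfrac{2C_{\rm step}T}{\lambda\epsilon}\right\}\right\rceil & (\Lambda(t)=e^{-\lambda t}),\\[2mm] \left\lceil\max\left\{1,\,T,\,\dfrac{C_{\rm step}T^2}{\epsilon}\right\}\right\rceil & (\Lambda(t)=1),\\[2mm] \left\lceil\max\left\{1,\,T,\,\lambda T,\,\dfrac{C_{\rm step}Te^{\lambda T}}{\lambda\epsilon}\right\}\right\rceil & (\Lambda(t)=e^{\lambda t}),\end{cases}\qquad \tau=\frac{T}{M}.$$ Let $\widetilde\Phi_h(\rho)=V(\rho,h)\rho V(\rho,h)^\dagger$ for $\rho\in\mathcal S_{\rm pure}$, $0<h\le1$, where $V(\rho,h)$ is unitary. Let $U_0$ be a unitary with $U_0|0\rangle=|\psi(0)\rangle$, $\rho_0=|\psi(0)\rangle\langle\psi(0)|\in\mathcal S_{\rm pure}$, $\rho(t)=\varphi_t(\rho_0)$, and for $k\in\{0,\dots,M-1\}$ let $\rho_{k+1}=\widetilde\Phi_\tau(\rho_k)$ and $U_{k+1}=V(\rho_k,\tau)U_k$. Suppose that $\Omega\subset\mathcal S_{\rm pure}$ satisfies: (i) $\{\rho(t)\mid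 t\in[0,T]\}\cup\{\rho_k\mid 0\le k\le M\}\subset\Omega$; (ii) $\|\varphi_t(\sigma_1)-\varphi_t(\sigma_2)\|_1\le\Lambda(t)\|\sigma_1-\sigma_2\|_1$ for all $\sigma_1,\sigma_2\in\Omega$, $t\ge0$; (iii) $\|\widetilde\Phi_h(\sigma)-\varphi_h(\sigma)\|_1\le C_{\rm step}h^2$ for all $\sigma\in\Omega$, $0<h\le1$, with $C_{\rm step}$ independent of $h$ and $\sigma$. Suppose also that each $V(\rho_k,\tau)$ admits an ancilla-free implementation using at most $b$ calls in total to $U_k$ and $U_k^\dagger$, uniformly in $k$. Then the total number $Q_M$ of queries to $U_0$ and $U_0^\dagger$ used to implement $U_M$ satisfies $$Q_M\le\begin{cases}\exp\left(O\left(\dfrac{T}{\epsilon}\log(1+b)\right)\right)&(\Lambda(t)=e^{-\lambda t}),\\[2mm]\exp\left(O\left(\dfrac{T^2}{\epsilon}\log(1+b)\right)\right)&(\Lambda(t)=1),\\[2mm]\exp\left(O\left(\dfrac{Te^{\lambda T}}{\epsilon}\log(1+b)\right)\right)&(\Lambda(t)=e^{\lambda t}),\end{cases}$$ where the implied constants depend only on the upper bound on $C_{\rm step}$ and, in the exponential cases, on $\lambda$.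
   Context: $\mathcal H$ is a finite-dimensional complex Hilbert space with a fixed unit reference vector $|0\rangle$, and $\mathcal S_{\rm pure}=\{|\psi\rangle\langle\psi| : |\psi\rangle\in\mathcal H,\ \langle\psi|\psi\rangle=1\}$. $\|\cdot\|_{\rm op}$ is the operator norm and $\|X\|_1=\operatorname{Tr}\sqrt{X^\dagger X}$ the trace norm. $G$ assigns to each $\rho\in\mathcal S_{\rm pure}$ a Hermitian operator $G(\rho)$ on $\mathcal H$, with finite constants $M_G,L_G\ge0$ such that $\|G(\rho)\|_{\rm op}\le M_G$ and $\|G(\rho)-G(\sigma)\|_{\rm op}\le L_G\|\rho-\sigma\|_1$ for all $\rho,\sigma\in\mathcal S_{\rm pure}$. For $\rho\in\mathcal S_{\rm pure}$ and $t\ge0$, $\varphi_t(\rho)\in\mathcal S_{\rm pure}$ denotes the solution at time $t$ of $\frac{d}{dt}\rho(t)=[[\rho(t),G(\rho(t))],\rho(t)]$ with $\rho(0)=\rho$. Circuit model: an ancilla-free implementation of a unitary on $\mathcal H$ using $q$ calls to $U$ and $U^\dagger$ is a factorization of it (up to global phase) into a product of unitaries on $\mathcal H$ in which $q$ factors are $U$ or $U^\dagger$ and the others are non-query gates. $Q_k$ is the number of calls to $U_0$ and $U_0^\dagger$ in the implementation of $U_k$ obtained by recursively expanding $U_{j+1}=V(\rho_j,\tau)U_j$, with $Q_0=1$; implementing $U_k^\dagger$ costs the same number of calls as $U_k$. "$C_{\rm step}=O(1)$" means that $C_{\rm step}$ is bounded above by a fixed constant. *)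

theory Defs
  imports "Jordan_Normal_Form.Schur_Decomposition"
begin

text \<open>The Hilbert space is \<open>carrier_vec d\<close> with \<open>d :: nat\<close>, so that constants can be chosen
  uniformly in the dimension. The inner product \<open>v \<bullet>c w\<close> of the library is linear in its first
  and conjugate linear in its second argument.\<close>

definition vnorm :: "complex vec \<Rightarrow> real" where
  "vnorm v = sqrt (Re (v \<bullet>c v))"

definition ket_bra :: "complex vec \<Rightarrow> complex mat" where
  "ket_bra \<psi> = mat (dim_vec \<psi>) (dim_vec \<psi>) (\<lambda>(i, j). \<psi> $ i * cnj (\<psi> $ j))"

definition pure_states :: "nat \<Rightarrow> complex mat set" where
  "pure_states d = {ket_bra \<psi> | \<psi>. \<psi> \<in> carrier_vec d \<and> \<psi> \<bullet>c \<psi> = 1}"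

definition hermitian :: "complex mat \<Rightarrow> bool" where
  "hermitian A \<longleftrightarrow> mat_adjoint A = A"

definition unitary :: "nat \<Rightarrow> complex mat \<Rightarrow> bool" where
  "unitary d U \<longleftrightarrow> U \<in> carrier_mat d d \<and> mat_adjoint U * U = 1\<^sub>m d \<and> U * mat_adjoint U = 1\<^sub>m d"

definition op_norm :: "complex mat \<Rightarrow> real" where
  "op_norm A = (SUP v \<in> {v \<in> carrier_vec (dim_col A). vnorm v = 1}. vnorm (A *\<^sub>v v))"

definition trace :: "complex mat \<Rightarrow> complex" where
  "trace A = (\<Sum>i<dim_row A. A $$ (i, i))"

definition psd :: "nat \<Rightarrow> complex mat \<Rightarrow> bool" where
  "psd d A \<longleftrightarrow> A \<in> carrier_mat d d \<and> hermitian A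
     \<and> (\<forall>v \<in> carrier_vec d. 0 \<le> Re ((A *\<^sub>v v) \<bullet>c v))"

text \<open>Every positive semidefinite matrix has exactly one positive semidefinite square root;
  the definite description below is only used for such matrices.\<close>

definition psd_sqrt :: "complex mat \<Rightarrow> complex mat" where
  "psd_sqrt A = (THE B. psd (dim_row A) B \<and> B * B = A)"

definition trace_norm :: "complex mat \<Rightarrow> real" where
  "trace_norm X = Re (trace (psd_sqrt (mat_adjoint X * X)))"

definition commutator :: "complex mat \<Rightarrow> complex mat \<Rightarrow> complex mat" where
  "commutator A B = A * B - B * A"

definition generator :: "nat \<Rightarrow> (complex mat \<Rightarrow> complex mat) \<Rightarrow> real \<Rightarrow> real \<Rightarrow> bool" where
  "generator d G MG LG \<longleftrightarrow> 0 \<le> MG \<and> 0 \<le> LG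
     \<and> (\<forall>\<rho> \<in> pure_states d. G \<rho> \<in> carrier_mat d d \<and> hermitian (G \<rho>) \<and> op_norm (G \<rho>) \<le> MG)
     \<and> (\<forall>\<rho> \<in> pure_states d. \<forall>\<sigma> \<in> pure_states d.
           op_norm (G \<rho> - G \<sigma>) \<le> LG * trace_norm (\<rho> - \<sigma>))"

text \<open>\<open>complex mat\<close> carries no topology, so the matrix differential equation is stated entrywise.
  At \<open>t = 0\<close> the derivative is one-sided.\<close>

definition double_bracket_flow ::
    "nat \<Rightarrow> (complex mat \<Rightarrow> complex mat) \<Rightarrow> (real \<Rightarrow> complex mat \<Rightarrow> complex mat) \<Rightarrow> bool" where
  "double_bracket_flow d G \<phi> \<longleftrightarrow>
     (\<forall>\<rho> \<in> pure_states d. \<phi> 0 \<rho> = \<rho> \<and>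
       (\<forall>t\<ge>0. \<phi> t \<rho> \<in> pure_states d \<and>
         (\<forall>i<d. \<forall>j<d.
           ((\<lambda>s. \<phi> s \<rho> $$ (i, j)) has_vector_derivative
             commutator (commutator (\<phi> t \<rho>) (G (\<phi> t \<rho>))) (\<phi> t \<rho>) $$ (i, j))
           (at t within {0..}))))"

definition step_map :: "(complex mat \<Rightarrow> real \<Rightarrow> complex mat) \<Rightarrow> real \<Rightarrow> complex mat \<Rightarrow> complex mat" where
  "step_map V h \<rho> = V \<rho> h * \<rho> * mat_adjoint (V \<rho> h)"

datatype regime = Contractive real | Nonexpansive | Expansive real

primrec valid_regime :: "regime \<Rightarrow> bool" where
  "valid_regime (Contractive l) \<longleftrightarrow> l > 0"
| "valid_regime Nonexpansive \<longleftrightarrow> True"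
| "valid_regime (Expansive l) \<longleftrightarrow> l > 0"

primrec stability_rate :: "regime \<Rightarrow> real \<Rightarrow> real" where
  "stability_rate (Contractive l) t = exp (- l * t)"
| "stability_rate Nonexpansive t = 1"
| "stability_rate (Expansive l) t = exp (l * t)"

primrec step_count :: "regime \<Rightarrow> real \<Rightarrow> real \<Rightarrow> real \<Rightarrow> nat" where
  "step_count (Contractive l) C T \<epsilon> = nat \<lceil>Max {1, T, l * T, 2 * C * T / (l * \<epsilon>)}\<rceil>"
| "step_count Nonexpansive C T \<epsilon> = nat \<lceil>Max {1, T, C * T^2 / \<epsilon>}\<rceil>"
| "step_count (Expansive l) C T \<epsilon> = nat \<lceil>Max {1, T, l * T, C * T * exp (l * T) / (l * \<epsilon>)}\<rceil>"

primrec query_scale :: "regime \<Rightarrow> real \<Rightarrow> real \<Rightarrow> real" where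
  "query_scale (Contractive l) T \<epsilon> = T / \<epsilon>"
| "query_scale Nonexpansive T \<epsilon> = T^2 / \<epsilon>"
| "query_scale (Expansive l) T \<epsilon> = T * exp (l * T) / \<epsilon>"

text \<open>A circuit is a list of factors, in the order in which they are written in the product;
  \<open>Query\<close> and \<open>Query_adj\<close> stand for the oracle unitary and its adjoint.\<close>

datatype gate = Query | Query_adj | Gate "complex mat"

primrec gate_mat :: "complex mat \<Rightarrow> gate \<Rightarrow> complex mat" where
  "gate_mat U Query = U"
| "gate_mat U Query_adj = mat_adjoint U"
| "gate_mat U (Gate W) = W"

definition circuit_mat :: "nat \<Rightarrow> complex mat \<Rightarrow> gate list \<Rightarrow> complex mat" where
  "circuit_mat d U c = foldr (\<lambda>g A. gate_mat U g * A) c (1\<^sub>m d)"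

definition implements :: "nat \<Rightarrow> complex mat \<Rightarrow> gate list \<Rightarrow> complex mat \<Rightarrow> bool" where
  "implements d U c W \<longleftrightarrow> (\<forall>A. Gate A \<in> set c \<longrightarrow> unitary d A)
     \<and> (\<exists>z. cmod z = 1 \<and> W = z \<cdot>\<^sub>m circuit_mat d U c)"

definition queries :: "gate list \<Rightarrow> nat" where
  "queries c = length (filter (\<lambda>g. g = Query \<or> g = Query_adj) c)"

primrec gate_adj :: "gate \<Rightarrow> gate" where
  "gate_adj Query = Query_adj"
| "gate_adj Query_adj = Query"
| "gate_adj (Gate W) = Gate (mat_adjoint W)"

definition circuit_adj :: "gate list \<Rightarrow> gate list" where
  "circuit_adj c = rev (map gate_adj c)"

primrec expand_gate :: "gate list \<Rightarrow> gate \<Rightarrow> gate list" where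
  "expand_gate e Query = e"
| "expand_gate e Query_adj = circuit_adj e"
| "expand_gate e (Gate W) = [Gate W]"

text \<open>If \<open>c k\<close> implements the \<open>k\<close>-th step in terms of \<open>U\<^sub>k\<close>, then \<open>unrolled_circuit c k\<close> implements
  \<open>U\<^sub>k\<close> in terms of \<open>U\<^sub>0\<close>; this is proved in \<open>implements_unrolled_circuit\<close>.\<close>

primrec unrolled_circuit :: "(nat \<Rightarrow> gate list) \<Rightarrow> nat \<Rightarrow> gate list" where
  "unrolled_circuit c 0 = [Query]"
| "unrolled_circuit c (Suc k) =
     concat (map (expand_gate (unrolled_circuit c k)) (c k)) @ unrolled_circuit c k"

lemma adjoint_dim [simp]:
  "dim_row (mat_adjoint A) = dim_col A" "dim_col (mat_adjoint A) = dim_row A"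
  by (auto simp: mat_adjoint_def)

lemma adjoint_index [simp]:
  "i < dim_col A \<Longrightarrow> j < dim_row A \<Longrightarrow> mat_adjoint A $$ (i, j) = conjugate (A $$ (j, i))"
  by (auto simp: mat_adjoint_def mat_of_rows_def)

lemma adjoint_carrier [simp]: "A \<in> carrier_mat n m \<Longrightarrow> mat_adjoint A \<in> carrier_mat m n"
  by (metis adjoint_dim carrier_matD carrier_matI)

lemma adjoint_adjoint [simp]: "mat_adjoint (mat_adjoint (A :: complex mat)) = A"
  by (rule eq_matI) simp_all

lemma adjoint_one [simp]: "mat_adjoint (1\<^sub>m d :: complex mat) = 1\<^sub>m d"
  by (rule eq_matI) simp_all

lemma adjoint_smult: "mat_adjoint (z \<cdot>\<^sub>m (A :: complex mat)) = cnj z \<cdot>\<^sub>m mat_adjoint A"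
  by (rule eq_matI) simp_all

lemma adjoint_mult:
  fixes A B :: "complex mat"
  assumes "A \<in> carrier_mat n m" "B \<in> carrier_mat m l"
  shows "mat_adjoint (A * B) = mat_adjoint B * mat_adjoint A"
proof (rule eq_matI)
  fix i j assume "i < dim_row (mat_adjoint B * mat_adjoint A)"
    "j < dim_col (mat_adjoint B * mat_adjoint A)"
  then have ij: "i < l" "j < n" using assms by auto
  have "mat_adjoint (A * B) $$ (i, j) = cnj (\<Sum>k<m. A $$ (j, k) * B $$ (k, i))"
    using assms ij by (simp add: scalar_prod_def atLeast0LessThan)
  also have "\<dots> = (\<Sum>k<m. cnj (B $$ (k, i)) * cnj (A $$ (j, k)))"
    by (simp add: mult.commute)
  also have "\<dots> = (mat_adjoint B * mat_adjoint A) $$ (i, j)"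
    using assms ij by (simp add: scalar_prod_def atLeast0LessThan)
  finally show "mat_adjoint (A * B) $$ (i, j) = (mat_adjoint B * mat_adjoint A) $$ (i, j)" .
qed (use assms in simp_all)

lemma one_smult: "1 \<cdot>\<^sub>m (A :: complex mat) = A"
  by (rule eq_matI) simp_all

lemma unitary_adjoint: "unitary d A \<Longrightarrow> unitary d (mat_adjoint A)"
  by (simp add: unitary_def)

context
  fixes d :: nat and U :: "complex mat"
  assumes U: "U \<in> carrier_mat d d"
begin

lemma circuit_mat_simps [simp]:
  "circuit_mat d W [] = 1\<^sub>m d"
  "circuit_mat d W (g # c) = gate_mat W g * circuit_mat d W c"
  by (auto simp: circuit_mat_def)

lemma gate_mat_carrier:
  "\<forall>A. Gate A \<in> set (g # c) \<longrightarrow> unitary d A \<Longrightarrow> gate_mat U g \<in> carrier_mat d d"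
  using U by (cases g) (auto simp: unitary_def)

lemma circuit_mat_carrier:
  "\<forall>A. Gate A \<in> set c \<longrightarrow> unitary d A \<Longrightarrow> circuit_mat d U c \<in> carrier_mat d d"
proof (induction c)
  case (Cons g c)
  then show ?case using gate_mat_carrier[OF Cons.prems] by auto
qed auto

lemma circuit_mat_append:
  "\<forall>A. Gate A \<in> set (c @ c') \<longrightarrow> unitary d A \<Longrightarrow>
     circuit_mat d U (c @ c') = circuit_mat d U c * circuit_mat d U c'"
proof (induction c)
  case Nil
  then show ?case using circuit_mat_carrier[of c'] by auto
next
  case (Cons g c)
  have "\<forall>A. Gate A \<in> set (g # c) \<longrightarrow> unitary d A" using Cons.prems by auto
  note g = gate_mat_carrier[OF this]
  have "circuit_mat d U c \<in> carrier_mat d d" "circuit_mat d U c' \<in> carrier_mat d d"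
    using Cons.prems by (auto intro!: circuit_mat_carrier)
  then show ?case using Cons g by (auto simp: assoc_mult_mat[OF g])
qed

lemma gates_circuit_adj:
  assumes "\<forall>A. Gate A \<in> set c \<longrightarrow> unitary d A" "Gate B \<in> set (circuit_adj c)"
  shows "unitary d B"
proof -
  obtain g where g: "g \<in> set c" "gate_adj g = Gate B" using assms(2) by (auto simp: circuit_adj_def)
  from g(2) obtain A where A: "g = Gate A" by (cases g) simp_all
  then have "unitary d A" using assms(1) g(1) by blast
  then show ?thesis using g(2) A unitary_adjoint[of d A] by simp
qed

lemma circuit_mat_adj:
  "\<forall>A. Gate A \<in> set c \<longrightarrow> unitary d A \<Longrightarrow>
     circuit_mat d U (circuit_adj c) = mat_adjoint (circuit_mat d U c)"
proof (induction c)
  case Nil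
  then show ?case by (simp add: circuit_adj_def)
next
  case (Cons g c)
  note g = gate_mat_carrier[OF Cons.prems]
  have c: "circuit_mat d U c \<in> carrier_mat d d"
    using Cons.prems by (auto intro!: circuit_mat_carrier)
  have eq: "circuit_adj (g # c) = circuit_adj c @ [gate_adj g]" by (simp add: circuit_adj_def)
  have "circuit_mat d U (circuit_adj (g # c)) =
      circuit_mat d U (circuit_adj c) * circuit_mat d U [gate_adj g]"
    unfolding eq
    by (intro circuit_mat_append allI impI, rule gates_circuit_adj[OF Cons.prems]) (simp add: eq)
  also have "circuit_mat d U [gate_adj g] = mat_adjoint (gate_mat U g)"
  proof -
    have "gate_mat U (gate_adj g) = mat_adjoint (gate_mat U g)" by (cases g) auto
    then show ?thesis using g by (auto simp: right_mult_one_mat[of _ d d])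
  qed
  finally show ?case using Cons g c by (simp add: adjoint_mult[OF g c])
qed

lemma gates_expand_gate:
  assumes "\<forall>A. Gate A \<in> set e \<longrightarrow> unitary d A" "\<forall>A. g = Gate A \<longrightarrow> unitary d A"
    "Gate B \<in> set (expand_gate e g)"
  shows "unitary d B"
proof (cases g)
  case Query_adj
  then show ?thesis using gates_circuit_adj[OF assms(1), of B] assms(3) by simp
qed (use assms in simp_all)

lemma implements_append:
  assumes "implements d U c A" "implements d U c' B"
  shows "implements d U (c @ c') (A * B)"
proof -
  from assms obtain z z' where z: "cmod z = 1" "A = z \<cdot>\<^sub>m circuit_mat d U c"
    and z': "cmod z' = 1" "B = z' \<cdot>\<^sub>m circuit_mat d U c'" by (auto simp: implements_def)
  have carr: "circuit_mat d U c \<in> carrier_mat d d" "circuit_mat d U c' \<in> carrier_mat d d"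
    using assms by (auto simp: implements_def intro!: circuit_mat_carrier)
  have gates: "\<forall>A. Gate A \<in> set (c @ c') \<longrightarrow> unitary d A" using assms by (auto simp: implements_def)
  have "A * B = (z * z') \<cdot>\<^sub>m circuit_mat d U (c @ c')"
    unfolding z z' circuit_mat_append[OF gates]
    using carr by (intro eq_matI) (auto simp: mult_ac)
  moreover have "cmod (z * z') = 1" using z z' by (simp add: norm_mult)
  ultimately show ?thesis using gates unfolding implements_def by blast
qed

lemma implements_expand:
  assumes e: "implements d U e W"
  shows "\<forall>A. Gate A \<in> set c \<longrightarrow> unitary d A \<Longrightarrow>
    implements d U (concat (map (expand_gate e) c)) (circuit_mat d W c)"
proof (induction c)
  case Nil
  have "1 \<cdot>\<^sub>m (1\<^sub>m d :: complex mat) = 1\<^sub>m d" by (rule one_smult)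
  then show ?case unfolding implements_def by (auto intro!: exI[of _ 1])
next
  case (Cons g c)
  have gates: "\<forall>A. Gate A \<in> set e \<longrightarrow> unitary d A" using e by (auto simp: implements_def)
  have "implements d U (expand_gate e g) (gate_mat W g)"
  proof (cases g)
    case Query
    then show ?thesis using e by simp
  next
    case Query_adj
    from e obtain z where z: "cmod z = 1" "W = z \<cdot>\<^sub>m circuit_mat d U e"
      by (auto simp: implements_def)
    then show ?thesis using Query_adj gates_circuit_adj[OF gates]
      by (auto simp: implements_def circuit_mat_adj[OF gates] adjoint_smult intro!: exI[of _ "cnj z"])
  next
    case (Gate A)
    then have "A \<in> carrier_mat d d" using Cons.prems by (auto simp: unitary_def)
    then have "1 \<cdot>\<^sub>m (A * 1\<^sub>m d) = A" by (simp add: one_smult)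
    then show ?thesis using Gate Cons.prems by (auto simp: implements_def intro!: exI[of _ 1])
  qed
  from implements_append[OF this Cons.IH] Cons.prems show ?case by auto
qed

end

lemma implements_unrolled_circuit:
  assumes U0: "Us 0 \<in> carrier_mat d d"
    and step: "\<And>k. k < M \<Longrightarrow> Us (Suc k) = Vs k * Us k"
    and impl: "\<And>k. k < M \<Longrightarrow> implements d (Us k) (c k) (Vs k)"
    and "k \<le> M"
  shows "implements d (Us 0) (unrolled_circuit c k) (Us k)"
  using \<open>k \<le> M\<close>
proof (induction k)
  case 0
  have "1 \<cdot>\<^sub>m (Us 0 * 1\<^sub>m d) = Us 0" using U0 by (simp add: one_smult)
  then show ?case unfolding implements_def circuit_mat_def by (intro conjI exI[of _ 1]) simp_all
next
  case (Suc k)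
  let ?e = "concat (map (expand_gate (unrolled_circuit c k)) (c k))"
  have IH: "implements d (Us 0) (unrolled_circuit c k) (Us k)" using Suc by simp
  from impl[of k] Suc.prems obtain z where gates: "\<forall>A. Gate A \<in> set (c k) \<longrightarrow> unitary d A"
    and z: "cmod z = 1" "Vs k = z \<cdot>\<^sub>m circuit_mat d (Us k) (c k)" by (auto simp: implements_def)
  from implements_expand[OF U0 IH gates]
  obtain y where y: "cmod y = 1" "circuit_mat d (Us k) (c k) = y \<cdot>\<^sub>m circuit_mat d (Us 0) ?e"
    and gates': "\<forall>A. Gate A \<in> set ?e \<longrightarrow> unitary d A" unfolding implements_def by blast
  have "Vs k = (z * y) \<cdot>\<^sub>m circuit_mat d (Us 0) ?e"
    unfolding z(2) y(2) by (rule eq_matI) (simp_all add: mult.assoc)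
  then have "implements d (Us 0) ?e (Vs k)"
    using gates' y(1) z(1) unfolding implements_def by (metis norm_mult mult_1)
  from implements_append[OF U0 this IH] show ?case using step[of k] Suc.prems by simp
qed

end

theory Submission
  imports Defs
begin

text \<open>Expanding one step multiplies the number of queries by at most \<open>b + 1\<close>, since the circuit of
  \<open>V(\<rho>\<^sub>k, \<tau>)\<close> contains at most \<open>b\<close> copies of \<open>U\<^sub>k\<close> or its adjoint and one more copy of \<open>U\<^sub>k\<close>
  follows. Hence \<open>Q\<^sub>M \<le> (1 + b) ^ M\<close>, and it remains to see that \<open>M\<close> is at most a constant times the
  query scale: every term of the maximum defining \<open>M\<close> is, because \<open>1 \<le> T\<close> and \<open>\<epsilon> \<le> 1\<close>, and the
  ceiling costs a factor of at most 2 because the maximum is at least 1.\<close>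

lemma queries_simps [simp]:
  "queries [] = 0"
  "queries (g # c) = (if g = Query \<or> g = Query_adj then 1 else 0) + queries c"
  "queries (c @ c') = queries c + queries c'"
  by (simp_all add: queries_def)

text \<open>\<open>gate_adj\<close> swaps the two kinds of query, and \<open>queries\<close> counts
  both. An inverse call is therefore expanded at the same cost as a forward call.\<close>

lemma queries_circuit_adj [simp]: "queries (circuit_adj c) = queries c"
proof (induction c)
  case (Cons g c)
  then show ?case by (cases g) (simp_all add: circuit_adj_def)
qed (simp add: circuit_adj_def)

text \<open>Each query in \<open>c\<close>, of either kind, turns into \<open>queries e\<close>
  queries, while a non-query gate stays a single gate that costs nothing.\<close>

lemma queries_expand: "queries (concat (map (expand_gate e) c)) = queries c * queries e"
proof (induction c)
  case (Cons g c)
  then show ?case by (cases g) simp_all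
qed simp

lemma queries_unrolled_circuit_le:
  assumes "\<And>k. k < m \<Longrightarrow> queries (c k) \<le> b"
  shows "queries (unrolled_circuit c m) \<le> (1 + b) ^ m"
  using assms
proof (induction m)
  case (Suc m)
  have "queries (unrolled_circuit c (Suc m)) = (1 + queries (c m)) * queries (unrolled_circuit c m)"
    by (simp add: queries_expand)
  also have "\<dots> \<le> (1 + b) * (1 + b) ^ m"
    using Suc by (intro mult_le_mono) simp_all
  finally show ?case by simp
qed simp

text \<open>For \<open>x \<ge> 1\<close> the ceiling is below \<open>x + 1 \<le> 2 * x\<close>; it
  is also positive, so \<open>nat\<close> truncates nothing.\<close>

lemma nat_ceiling_Max_le:
  fixes A :: "real set"
  assumes "finite A" "1 \<in> A" "\<And>x. x \<in> A \<Longrightarrow> x \<le> B"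
  shows "real (nat \<lceil>Max A\<rceil>) \<le> 2 * B"
proof -
  have "1 \<le> Max A" using assms by simp
  moreover have "Max A \<le> B" using assms by (subst Max_le_iff) auto
  ultimately show ?thesis by linarith
qed

text \<open>The order of quantifiers matters: \<open>K\<close> is fixed before \<open>C\<close>,
  \<open>T\<close> and \<open>\<epsilon>\<close>, so it can depend only on \<open>Cbar\<close> and
  on the regime with its rate.\<close>

lemma step_count_le_query_scale:
  assumes "valid_regime r"
  shows "\<exists>K>0. \<forall>C T \<epsilon>. 0 < C \<longrightarrow> C \<le> Cbar \<longrightarrow> 1 \<le> T \<longrightarrow> 0 < \<epsilon> \<longrightarrow> \<epsilon> \<le> 1 \<longrightarrow>
    real (step_count r C T \<epsilon>) \<le> K * query_scale r T \<epsilon>"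
proof -
  \<comment> \<open>Applied below also with \<open>T\<^sup>2\<close> and
    \<open>T * exp (l * T)\<close> in place of \<open>T\<close>.\<close>
  have T_le: "T \<le> T / \<epsilon>" if "1 \<le> T" "0 < \<epsilon>" "\<epsilon> \<le> 1" for T \<epsilon> :: real
    using that by (simp add: le_divide_eq)
  show ?thesis
  proof (cases r)
    case (Contractive l)
    have l: "0 < l" using assms Contractive by simp
    \<comment> \<open>The summands are the factors of \<open>s\<close> that dominate, in turn, the
      terms 1 and \<open>T\<close>, the term \<open>l * T\<close>, and the term with
      \<open>C\<close>. The absolute value keeps \<open>?K\<close> positive for every sign of
      \<open>Cbar\<close>.\<close>
    let ?K = "1 + l + 2 * \<bar>Cbar\<bar> / l"
    have "real (step_count r C T \<epsilon>) \<le> 2 * ?K * query_scale r T \<epsilon>"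
      if C: "0 < C" "C \<le> Cbar" and T: "1 \<le> T" "0 < \<epsilon>" "\<epsilon> \<le> 1" for C T \<epsilon>
    proof -
      define s where "s = T / \<epsilon>"
      have s: "T \<le> s" "1 \<le> s" using T_le[OF T] T by (auto simp: s_def)
      have "l * T \<le> l * s" using l s by simp
      moreover have "2 * C * T / (l * \<epsilon>) \<le> 2 * \<bar>Cbar\<bar> / l * s"
      proof -
        have "2 * C * T / (l * \<epsilon>) = 2 * C / l * s" by (simp add: s_def)
        also have "\<dots> \<le> 2 * \<bar>Cbar\<bar> / l * s"
          using C l s by (intro mult_right_mono divide_right_mono) auto
        finally show ?thesis .
      qed
      moreover have "0 \<le> l * s" "0 \<le> 2 * \<bar>Cbar\<bar> / l * s" using l s by simp_all
      \<comment> \<open>Once the product is expanded, each term of the maximum lies below one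
        summand and the remaining summands are nonnegative, which is a linear argument.\<close>
      moreover have "?K * s = s + l * s + 2 * \<bar>Cbar\<bar> / l * s" by (simp add: distrib_right)
      ultimately have le: "x \<le> ?K * s" if "x \<in> {1, T, l * T, 2 * C * T / (l * \<epsilon>)}" for x
        using that s by (elim insertE emptyE) linarith+
      show ?thesis
        \<comment> \<open>Regrouping as \<open>2 * (?K * s)\<close> gives the shape of
          \<open>nat_ceiling_Max_le\<close> with \<open>B = ?K * s\<close>.\<close>
        unfolding Contractive step_count.simps query_scale.simps s_def[symmetric] mult.assoc[of 2 ?K]
        by (intro nat_ceiling_Max_le le) simp_all
    qed
    moreover have "0 < 2 * ?K" using l by (simp add: add_pos_nonneg)
    ultimately show ?thesis by blast
  next
    case Nonexpansive
    let ?K = "1 + \<bar>Cbar\<bar>"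
    have "real (step_count r C T \<epsilon>) \<le> 2 * ?K * query_scale r T \<epsilon>"
      if C: "0 < C" "C \<le> Cbar" and T: "1 \<le> T" "0 < \<epsilon>" "\<epsilon> \<le> 1" for C T \<epsilon>
    proof -
      define s where "s = T\<^sup>2 / \<epsilon>"
      \<comment> \<open>The scale is now quadratic in \<open>T\<close>; \<open>1 \<le> T\<close>
        lets it absorb the linear term.\<close>
      have "T \<le> T\<^sup>2" using T by (simp add: power2_eq_square)
      moreover have "T\<^sup>2 \<le> s" using T_le[of "T\<^sup>2" \<epsilon>] T by (simp add: s_def)
      ultimately have s: "T \<le> s" "1 \<le> s" using T by linarith+
      have "C * T\<^sup>2 / \<epsilon> \<le> \<bar>Cbar\<bar> * s"
      proof -
        have "C * T\<^sup>2 / \<epsilon> = C * s" by (simp add: s_def)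
        also have "\<dots> \<le> \<bar>Cbar\<bar> * s" using C s by (intro mult_right_mono) auto
        finally show ?thesis .
      qed
      moreover have "0 \<le> \<bar>Cbar\<bar> * s" using s by simp
      moreover have "?K * s = s + \<bar>Cbar\<bar> * s" by (simp add: distrib_right)
      ultimately have le: "x \<le> ?K * s" if "x \<in> {1, T, C * T\<^sup>2 / \<epsilon>}" for x
        using that s by (elim insertE emptyE) linarith+
      show ?thesis
        unfolding Nonexpansive step_count.simps query_scale.simps s_def[symmetric] mult.assoc[of 2 ?K]
        by (intro nat_ceiling_Max_le le) simp_all
    qed
    moreover have "0 < 2 * ?K" by (simp add: add_pos_nonneg)
    ultimately show ?thesis by blast
  next
    case (Expansive l)
    have l: "0 < l" using assms Expansive by simp
    let ?K = "1 + l + \<bar>Cbar\<bar> / l"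
    have "real (step_count r C T \<epsilon>) \<le> 2 * ?K * query_scale r T \<epsilon>"
      if C: "0 < C" "C \<le> Cbar" and T: "1 \<le> T" "0 < \<epsilon>" "\<epsilon> \<le> 1" for C T \<epsilon>
    proof -
      define s where "s = T * exp (l * T) / \<epsilon>"
      \<comment> \<open>The exponent is positive, so the exponential factor of the scale only helps;
        it cancels against the one in the term with \<open>C\<close>.\<close>
      have "T \<le> T * exp (l * T)" using T l by simp
      moreover have "T * exp (l * T) \<le> s"
        using T_le[of "T * exp (l * T)" \<epsilon>] T calculation by (simp add: s_def)
      ultimately have s: "T \<le> s" "1 \<le> s" using T by linarith+
      have "l * T \<le> l * s" using l s by simp
      moreover have "C * T * exp (l * T) / (l * \<epsilon>) \<le> \<bar>Cbar\<bar> / l * s"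
      proof -
        have "C * T * exp (l * T) / (l * \<epsilon>) = C / l * s" by (simp add: s_def)
        also have "\<dots> \<le> \<bar>Cbar\<bar> / l * s"
          using C l s by (intro mult_right_mono divide_right_mono) auto
        finally show ?thesis .
      qed
      moreover have "0 \<le> l * s" "0 \<le> \<bar>Cbar\<bar> / l * s" using l s by simp_all
      moreover have "?K * s = s + l * s + \<bar>Cbar\<bar> / l * s" by (simp add: distrib_right)
      ultimately have le: "x \<le> ?K * s"
        if "x \<in> {1, T, l * T, C * T * exp (l * T) / (l * \<epsilon>)}" for x
        using that s by (elim insertE emptyE) linarith+
      show ?thesis
        unfolding Expansive step_count.simps query_scale.simps s_def[symmetric] mult.assoc[of 2 ?K]
        by (intro nat_ceiling_Max_le le) simp_all
    qed
    moreover have "0 < 2 * ?K" using l by (simp add: add_pos_nonneg)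
    ultimately show ?thesis by blast
  qed
qed

theorem corollary7:
  fixes r :: regime and Cbar :: real
  assumes "valid_regime r"
  shows "\<exists>K>0. \<forall>(d :: nat) (ket0 :: complex vec) (\<psi>0 :: complex vec)
      (G :: complex mat \<Rightarrow> complex mat) (MG :: real) (LG :: real)
      (\<phi> :: real \<Rightarrow> complex mat \<Rightarrow> complex mat) (V :: complex mat \<Rightarrow> real \<Rightarrow> complex mat)
      (\<rho> :: nat \<Rightarrow> complex mat) (U :: nat \<Rightarrow> complex mat) (\<Omega> :: complex mat set)
      (T :: real) (\<epsilon> :: real) (C :: real) (M :: nat) (\<tau> :: real)
      (b :: nat) (c :: nat \<Rightarrow> gate list).
    ket0 \<in> carrier_vec d \<longrightarrow> ket0 \<bullet>c ket0 = 1 \<longrightarrow>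
    generator d G MG LG \<longrightarrow>
    double_bracket_flow d G \<phi> \<longrightarrow>
    1 \<le> T \<longrightarrow> 0 < \<epsilon> \<longrightarrow> \<epsilon> \<le> 1 \<longrightarrow>
    0 < C \<longrightarrow> C \<le> Cbar \<longrightarrow>
    M = step_count r C T \<epsilon> \<longrightarrow> \<tau> = T / real M \<longrightarrow>
    (\<forall>\<sigma> \<in> pure_states d. \<forall>h. 0 < h \<and> h \<le> 1 \<longrightarrow> unitary d (V \<sigma> h)) \<longrightarrow>
    unitary d (U 0) \<longrightarrow> U 0 *\<^sub>v ket0 = \<psi>0 \<longrightarrow> \<rho> 0 = ket_bra \<psi>0 \<longrightarrow>
    (\<forall>k<M. \<rho> (Suc k) = step_map V \<tau> (\<rho> k) \<and> U (Suc k) = V (\<rho> k) \<tau> * U k) \<longrightarrow>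
    \<Omega> \<subseteq> pure_states d \<longrightarrow>
    {\<phi> t (\<rho> 0) | t. 0 \<le> t \<and> t \<le> T} \<union> {\<rho> k | k. k \<le> M} \<subseteq> \<Omega> \<longrightarrow>
    (\<forall>\<sigma>1 \<in> \<Omega>. \<forall>\<sigma>2 \<in> \<Omega>. \<forall>t\<ge>0.
       trace_norm (\<phi> t \<sigma>1 - \<phi> t \<sigma>2) \<le> stability_rate r t * trace_norm (\<sigma>1 - \<sigma>2)) \<longrightarrow>
    (\<forall>\<sigma> \<in> \<Omega>. \<forall>h. 0 < h \<and> h \<le> 1 \<longrightarrow>
       trace_norm (step_map V h \<sigma> - \<phi> h \<sigma>) \<le> C * h^2) \<longrightarrow>
    (\<forall>k<M. implements d (U k) (c k) (V (\<rho> k) \<tau>) \<and> queries (c k) \<le> b) \<longrightarrow>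
    real (queries (unrolled_circuit c M)) \<le> exp (K * (query_scale r T \<epsilon> * ln (1 + real b)))"
proof -
  obtain K where K: "K > 0" "\<And>C T \<epsilon>. 0 < C \<Longrightarrow> C \<le> Cbar \<Longrightarrow> 1 \<le> T \<Longrightarrow> 0 < \<epsilon> \<Longrightarrow> \<epsilon> \<le> 1 \<Longrightarrow>
    real (step_count r C T \<epsilon>) \<le> K * query_scale r T \<epsilon>"
    using step_count_le_query_scale[OF assms] by blast
  have bound: "real (queries (unrolled_circuit c M)) \<le> exp (K * (query_scale r T \<epsilon> * ln (1 + real b)))"
    if "1 \<le> T" "0 < \<epsilon>" "\<epsilon> \<le> 1" "0 < C" "C \<le> Cbar" "M = step_count r C T \<epsilon>"
      "\<And>k. k < M \<Longrightarrow> queries (c k) \<le> b" for c M T \<epsilon> C b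
  proof -
    have "real (queries (unrolled_circuit c M)) \<le> real ((1 + b) ^ M)"
      using queries_unrolled_circuit_le that(7) of_nat_le_iff by blast
    also have "\<dots> = exp (real M * ln (1 + real b))" by (simp add: exp_of_nat_mult)
    \<comment> \<open>The logarithm is nonnegative because \<open>1 + b \<ge> 1\<close>, so the
      bound on \<open>M\<close> carries over to the exponent; for \<open>b = 0\<close> both sides
      equal 1.\<close>
    also have "\<dots> \<le> exp (K * query_scale r T \<epsilon> * ln (1 + real b))"
      using K(2) that by (simp add: mult_right_mono)
    finally show ?thesis by (simp add: mult.assoc)
  qed
  show ?thesis using K(1) by (intro exI[of _ K] conjI allI impI bound) auto
qed

end
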